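(* The homeomorphism $Q_E$ of $[0,1]$ linearizes the even Farey map $F_E$ and the even Gauss map $T_E$ as follows: $$\text{(i)}\quad Q_E\circ F_E\circ Q_E^{-1}=\overline{F}_E,\qquad\qquad \text{(ii)}\quad Q_E\circ T_E\circ Q_E^{-1}=\overline{T}_E .$$
   Context: Even continued fractions (ECF). Write $$[(e_1,a_1),(e_2,a_2),\ldots,(e_n,a_n)]=\cfrac{e_1}{a_1+\cfrac{e_2}{a_2+\cdots+\cfrac{e_n}{a_n}}}.$$ A finite ECF expansion has $e_i\in\{\pm1\}$ and every $a_i$ a positive even integer, except that the last partial quotient $a_n$ is also allowed to equal $1$ provided $e_n=1$. For numbers in $(0,1]$ one has $e_1=1$. With this convention every rational in $(0,1]$ has a unique finite ECF expansion; $0$ has the empty expansion. For $k\ge 0$ let $\mathcal{Y}_k$ be the set of rationals in $[0,1]$ whose finite ECF expansion satisfies $a_1+\cdots+a_n\le 2k+1$ (in particular $0,1\in\mathcal{Y}_k$); it has $3^k+1$ elements. For $x\in\mathcal{Y}_k$ define $Q_E(x)=3^{-k}|\{y\in\mathcal{Y}_k: y<x\}|$, which does not depend on the choice of $k$ with $x\in\mathcal{Y}_k$. For arbitrary $x\in[0,1]$, $Q_E(x)=\lim_{n\to\infty}3^{-n}|\{y\in\mathcal{Y}_n:y<x\}|$, which agrees with the previous definition for rational $x$ and is the extension of $Q_E$ from $\mathbb{Q}\cap[0,1]$ to $[0,1]$ by continuity. The even Farey map $F_E:[0,1]\to[0,1]$ is $$F_E(x)=\begin{cases}\frac{x}{1-2x}&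 0\le x\le\frac13\\ \frac1x-2&\frac13\le x\le\frac12\\ 2-\frac1x&\frac12\le x\le1.\end{cases}$$ The even Gauss map $T_E:[0,1]\to[0,1]$ is given by $T_E(0)=0$ and $T_E(x)=\left|\frac1x-2k\right|$ for $x\in\left[\frac1{2k+1},\frac1{2k-1}\right]$, $k\ge1$. The piecewise linear maps $\overline{F}_E,\overline{T}_E:[0,1]\to[0,1]$ are $$\overline{F}_E(y)=\begin{cases}3y& y\in[0,\frac13]\\ 2-3y&y\in[\frac13,\frac23]\\ 3y-2&y\in[\frac23,1]\end{cases}\qquad \overline{T}_E(y)=\begin{cases}2-3^ky& y\in[3^{-k},2\cdot3^{-k}],\ k\ge1\\ 3^ky-2&y\in[2\cdot3^{-k},3^{-k+1}],\ k\ge1,\end{cases}$$ with $\overline{T}_E(0)=0$. *)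

theory Defs
  imports "HOL-Analysis.Analysis"
begin

fun ecf_val :: "(int \<times> nat) list \<Rightarrow> real" where
  "ecf_val [] = 0"
| "ecf_val ((e, a) # ts) = of_int e / (of_nat a + ecf_val ts)"

text \<open>Finite even continued fraction expansions of numbers in \<open>[0,1]\<close>, whence the leading sign
  \<open>e\<^sub>1 = 1\<close>; the empty list is the expansion of \<open>0\<close>.\<close>

definition ecf_expansion :: "(int \<times> nat) list \<Rightarrow> bool" where
  "ecf_expansion ts \<longleftrightarrow>
     (\<forall>(e, a) \<in> set ts. e = 1 \<or> e = -1) \<and>
     (\<forall>(e, a) \<in> set (butlast ts). even a \<and> a > 0) \<and>
     (ts \<noteq> [] \<longrightarrow>
        (case last ts of (e, a) \<Rightarrow> (even a \<and> a > 0) \<or> (a = 1 \<and> e = 1)) \<and>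
        fst (hd ts) = 1)"

definition ecf_level :: "nat \<Rightarrow> real set" where
  "ecf_level k = {x \<in> \<rat> \<inter> {0..1}.
     \<exists>ts. ecf_expansion ts \<and> ecf_val ts = x \<and> sum_list (map snd ts) \<le> 2 * k + 1}"

definition Q_E :: "real \<Rightarrow> real" where
  "Q_E x = lim (\<lambda>n. real (card {y \<in> ecf_level n. y < x}) / 3 ^ n)"

definition F_E :: "real \<Rightarrow> real" where
  "F_E x = (if x \<le> 1/3 then x / (1 - 2 * x)
            else if x \<le> 1/2 then 1 / x - 2
            else 2 - 1 / x)"

definition F_E_bar :: "real \<Rightarrow> real" where
  "F_E_bar y = (if y \<le> 1/3 then 3 * y
                else if y \<le> 2/3 then 2 - 3 * y
                else 3 * y - 2)"

text \<open>The branches of the following two maps overlap at the endpoints of the intervals, where they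
  agree; hence the descriptions are well defined on \<open>[0,1]\<close>, as the lemmas below confirm.\<close>

definition T_E :: "real \<Rightarrow> real" where
  "T_E x = (if x = 0 then 0 else
     (THE v. \<exists>k::nat. k \<ge> 1 \<and> x \<in> {1 / (2 * real k + 1) .. 1 / (2 * real k - 1)}
                 \<and> v = \<bar>1 / x - 2 * real k\<bar>))"

definition T_E_bar :: "real \<Rightarrow> real" where
  "T_E_bar y = (if y = 0 then 0 else
     (THE v. \<exists>k::nat. k \<ge> 1 \<and>
        (y \<in> {1 / 3 ^ k .. 2 / 3 ^ k} \<and> v = 2 - 3 ^ k * y \<or>
         y \<in> {2 / 3 ^ k .. 3 / 3 ^ k} \<and> v = 3 ^ k * y - 2)))"

lemma T_E_0: "T_E 0 = 0"
  by (simp add: T_E_def)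

lemma T_E_eq:
  assumes k: "k \<ge> 1" and x: "x \<in> {1 / (2 * real k + 1) .. 1 / (2 * real k - 1)}"
  shows "T_E x = \<bar>1 / x - 2 * real k\<bar>"
proof -
  have "0 < 1 / (2 * real k + 1)" by simp
  also have "\<dots> \<le> x" using x by simp
  finally have pos: "x > 0" .
  have bnd: "2 * real j - 1 \<le> 1 / x \<and> 1 / x \<le> 2 * real j + 1"
    if j: "j \<ge> 1" "x \<in> {1 / (2 * real j + 1) .. 1 / (2 * real j - 1)}" for j :: nat
  proof -
    have p: "2 * real j - 1 > 0" "2 * real j + 1 > 0" using j(1) by linarith+
    have "x * (2 * real j - 1) \<le> 1"
      using j(2) p(1) by (simp add: pos_le_divide_eq)
    moreover have "1 \<le> x * (2 * real j + 1)"
      using j(2) p(2) by (simp add: pos_divide_le_eq)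
    ultimately show ?thesis
      using pos by (simp add: pos_le_divide_eq pos_divide_le_eq mult.commute)
  qed
  have uniq: "v = \<bar>1 / x - 2 * real k\<bar>"
    if "\<exists>j::nat. j \<ge> 1 \<and> x \<in> {1 / (2 * real j + 1) .. 1 / (2 * real j - 1)}
          \<and> v = \<bar>1 / x - 2 * real j\<bar>" for v
  proof -
    from that obtain j :: nat
      where j: "j \<ge> 1" "x \<in> {1 / (2 * real j + 1) .. 1 / (2 * real j - 1)}"
        and v: "v = \<bar>1 / x - 2 * real j\<bar>" by blast
    have "j = k \<or> real j \<ge> real k + 1 \<or> real k \<ge> real j + 1" by linarith
    then show ?thesis
      using bnd[OF j] bnd[OF k x] v by linarith
  qed
  have "(THE v. \<exists>j::nat. j \<ge> 1 \<and> x \<in> {1 / (2 * real j + 1) .. 1 / (2 * real j - 1)}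
          \<and> v = \<bar>1 / x - 2 * real j\<bar>) = \<bar>1 / x - 2 * real k\<bar>"
    by (rule the_equality) (use k x uniq in blast)+
  then show ?thesis
    using pos unfolding T_E_def by (metis less_irrefl)
qed

lemma T_E_bar_0: "T_E_bar 0 = 0"
  by (simp add: T_E_bar_def)

lemma T_E_bar_eq:
  fixes y v :: real and k :: nat
  assumes k: "k \<ge> 1"
    and v: "y \<in> {1 / 3 ^ k .. 2 / 3 ^ k} \<and> v = 2 - 3 ^ k * y \<or>
            y \<in> {2 / 3 ^ k .. 3 / 3 ^ k} \<and> v = 3 ^ k * y - 2"
  shows "T_E_bar y = v"
proof -
  have range: "1 \<le> 3 ^ i * y \<and> 3 ^ i * y \<le> 3 \<and> w = \<bar>3 ^ i * y - 2\<bar>"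
    if "y \<in> {1 / 3 ^ i .. 2 / 3 ^ i} \<and> w = 2 - 3 ^ i * y \<or>
        y \<in> {2 / 3 ^ i .. 3 / 3 ^ i} \<and> w = 3 ^ i * y - 2" for i :: nat and w
  proof -
    have p: "(3::real) ^ i > 0" by simp
    from that show ?thesis
    proof (elim disjE conjE)
      assume "y \<in> {1 / 3 ^ i .. 2 / 3 ^ i}" and w: "w = 2 - 3 ^ i * y"
      then have "1 \<le> 3 ^ i * y" "3 ^ i * y \<le> 2"
        using p by (simp_all add: pos_le_divide_eq pos_divide_le_eq mult.commute)
      then show ?thesis using w by linarith
    next
      assume "y \<in> {2 / 3 ^ i .. 3 / 3 ^ i}" and w: "w = 3 ^ i * y - 2"
      then have "2 \<le> 3 ^ i * y" "3 ^ i * y \<le> 3"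
        using p by (simp_all add: pos_le_divide_eq pos_divide_le_eq mult.commute)
      then show ?thesis using w by linarith
    qed
  qed
  have "0 < 3 ^ k * y" using range[OF v] by linarith
  then have pos: "y > 0" by (simp add: zero_less_mult_iff)
  have step: "3 ^ i * y = 1 \<and> 3 ^ j * y = 3"
    if "i < j" "3 ^ i * y \<ge> 1" "3 ^ j * y \<le> 3" for i j :: nat
  proof -
    have "(3::real) ^ Suc i \<le> 3 ^ j" using that(1) by (intro power_increasing) auto
    then have "3 ^ Suc i * y \<le> 3 ^ j * y" using pos by (intro mult_right_mono) auto
    then have "3 * (3 ^ i * y) \<le> 3 ^ j * y" by (simp add: mult.assoc)
    then show ?thesis using that by linarith
  qed
  have uniq: "w = v"
    if "\<exists>j::nat. j \<ge> 1 \<and> (y \<in> {1 / 3 ^ j .. 2 / 3 ^ j} \<and> w = 2 - 3 ^ j * y \<or>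
        y \<in> {2 / 3 ^ j .. 3 / 3 ^ j} \<and> w = 3 ^ j * y - 2)" for w
  proof -
    from that obtain j :: nat
      where "y \<in> {1 / 3 ^ j .. 2 / 3 ^ j} \<and> w = 2 - 3 ^ j * y \<or>
        y \<in> {2 / 3 ^ j .. 3 / 3 ^ j} \<and> w = 3 ^ j * y - 2" by blast
    note A = range[OF this] and B = range[OF v]
    consider "j = k" | "j < k" | "k < j" by linarith
    then show ?thesis
    proof cases
      case 1
      then show ?thesis using A B by metis
    next
      case 2
      then show ?thesis using A B step[of j k] by linarith
    next
      case 3
      then show ?thesis using A B step[of k j] by linarith
    qed
  qed
  have "(THE w. \<exists>j::nat. j \<ge> 1 \<and> (y \<in> {1 / 3 ^ j .. 2 / 3 ^ j} \<and> w = 2 - 3 ^ j * y \<or>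
        y \<in> {2 / 3 ^ j .. 3 / 3 ^ j} \<and> w = 3 ^ j * y - 2)) = v"
    by (rule the_equality) (use k v uniq in blast)+
  then show ?thesis
    using pos unfolding T_E_bar_def by (metis less_irrefl)
qed

end

theory Submission imports Defs begin

text \<open>Write \<open>Y\<^sub>n\<close> for the level \<open>ecf_level n\<close>. Each of the three branches of \<^term>\<open>F_E\<close> maps its
  interval monotonically onto \<open>[0,1]\<close>, increasing, decreasing and increasing in turn, just as the
  branches of \<^term>\<open>F_E_bar\<close> do. The arithmetic input is that \<^term>\<open>F_E\<close> removes \<open>2\<close> from the
  digit sum of every even continued fraction other than its fixed points \<open>0\<close> and \<open>1\<close>, so that
  \<open>Y\<^sub>n\<^sub>+\<^sub>1\<close> is the preimage of \<open>Y\<^sub>n\<close> under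
  \<^term>\<open>F_E\<close> (\<open>ecf_level_Suc_iff\<close>). Counting the points of \<open>Y\<^sub>n\<^sub>+\<^sub>1\<close> below \<open>x\<close> therefore reduces,
  branch by branch, to counting the points of \<open>Y\<^sub>n\<close> on one side of \<open>F_E x\<close>. After division by
  \<open>3\<^sup>n\<close> this reads \<open>q\<^sub>n\<^sub>+\<^sub>1(x) = h\<^sub>x(q\<^sub>n(F_E x))\<close>, where \<open>h\<^sub>x\<close> is the inverse of the branch of
  \<^term>\<open>F_E_bar\<close> that corresponds to the branch of \<^term>\<open>F_E\<close> at \<open>x\<close>, with an error of at most
  \<open>3\<^sup>-\<^sup>n\<^sup>-\<^sup>1\<close> (\<open>Q_approx_Suc\<close>).

  All \<open>h\<^sub>x\<close> are contractions with factor \<open>1/3\<close>. Hence the step functions \<open>q\<^sub>n\<close> have the same limit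
  as the continuous functions obtained from the identity by iterating \<open>\<phi> \<mapsto> (x \<mapsto> h\<^sub>x(\<phi>(F_E x)))\<close>,
  and these converge uniformly. So \<^term>\<open>Q_E\<close> is continuous and satisfies
  \<open>Q_E x = h\<^sub>x(Q_E(F_E x))\<close> (\<open>Q_E_functional_equation\<close>); applying \<^term>\<open>F_E_bar\<close> to both sides
  gives the conjugacy for \<^term>\<open>F_E\<close>, once \<^term>\<open>Q_E\<close> is known to be bijective.

  \<^term>\<open>Q_E\<close> is increasing because the counts are. It is strictly increasing because \<^term>\<open>F_E\<close>
  reduces denominators, so that every rational of \<open>[0,1]\<close> belongs to some level, and because
  the recursion is exact when \<open>F_E x\<close> lies in \<open>Y\<^sub>n\<close>, so that on \<open>Y\<^sub>n\<close> the limit \<^term>\<open>Q_E\<close> agrees with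
  the counting function \<open>q\<^sub>n\<close>, which separates the points of \<open>Y\<^sub>n\<close>.

  The conjugacy for \<^term>\<open>T_E\<close> follows from the one for \<^term>\<open>F_E\<close> by acceleration: on the interval of index \<open>k\<close> the map \<^term>\<open>T_E\<close> consists of \<open>k - 1\<close> applications of the branch
  of \<^term>\<open>F_E\<close> at \<open>0\<close>, each of which multiplies \<^term>\<open>Q_E\<close> by \<open>3\<close>
  (\<open>Q_E_neutral_branch\<close>), followed by one application of \<^term>\<open>F_E\<close> on \<open>[1/3,1]\<close>.\<close>

section \<open>Even continued fractions and the even Farey map\<close>

text \<open>The expansions without the condition on the leading sign. Unlike \<^term>\<open>ecf_expansion\<close>, this
  class is closed under removing the first term, which makes inductions possible.\<close>
fun ecf_tail :: "(int \<times> nat) list \<Rightarrow> bool" where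
  "ecf_tail [] = True"
| "ecf_tail ((e, a) # ts) =
     ((e = 1 \<or> e = -1) \<and> (even a \<and> a > 0 \<or> ts = [] \<and> a = 1 \<and> e = 1) \<and> ecf_tail ts)"

lemma ecf_expansion_Nil: "ecf_expansion []"
  by (simp add: ecf_expansion_def)

lemma ecf_tail_iff:
  "ecf_tail ts \<longleftrightarrow>
     (\<forall>(e, a) \<in> set ts. e = 1 \<or> e = -1) \<and>
     (\<forall>(e, a) \<in> set (butlast ts). even a \<and> a > 0) \<and>
     (ts \<noteq> [] \<longrightarrow> (case last ts of (e, a) \<Rightarrow> (even a \<and> a > 0) \<or> (a = 1 \<and> e = 1)))"
  by (induction ts rule: ecf_tail.induct) auto

lemma ecf_expansion_iff_tail:
  "ecf_expansion ts \<longleftrightarrow> ecf_tail ts \<and> (ts \<noteq> [] \<longrightarrow> fst (hd ts) = 1)"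
  unfolding ecf_tail_iff ecf_expansion_def by auto

lemma ecf_expansion_Cons:
  "ecf_expansion ((e, a) # ts) \<longleftrightarrow>
     e = 1 \<and> (even a \<and> a > 0 \<or> ts = [] \<and> a = 1) \<and> ecf_tail ts"
  by (auto simp: ecf_expansion_iff_tail)

text \<open>The lower bound is strict because a term \<open>(-1, 1)\<close> is excluded; this strictness keeps every
  denominator \<open>a + ecf_val ts\<close> with \<open>a \<ge> 2\<close> above \<open>1\<close>.\<close>
lemma ecf_val_tail_bounds:
  assumes "ecf_tail ts"
  shows "-1 < ecf_val ts \<and> ecf_val ts \<le> 1"
  using assms
proof (induction ts rule: ecf_tail.induct)
  case (2 e a ts)
  show ?case
  proof (cases "even a \<and> a > 0")
    case True
    then have "real a \<ge> 2" by (auto elim!: evenE)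
    then have "real a + ecf_val ts > 1" using 2 by auto
    then show ?thesis using 2 by (auto simp: field_simps)
  qed (use 2 in auto)
qed auto

lemma ecf_val_rational: "ecf_val ts \<in> \<rat>"
  by (induction ts rule: ecf_val.induct) auto

lemma ecf_val_Cons_pos:
  assumes "ecf_tail ((1, a) # ts)"
  shows "ecf_val ((1, a) # ts) > 0"
proof -
  have "real a \<ge> 1" using assms by auto
  moreover have "ecf_val ts > -1" using ecf_val_tail_bounds assms by auto
  ultimately show ?thesis by simp
qed

lemma ecf_val_expansion_range:
  assumes "ecf_expansion ts"
  shows "ecf_val ts \<in> {0..1}"
proof (cases ts)
  case (Cons p us)
  then obtain a where "ts = (1, a) # us"
    using assms by (cases p) (auto simp: ecf_expansion_Cons)
  then show ?thesis
    using assms ecf_val_Cons_pos[of a us] ecf_val_tail_bounds[of ts]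
    by (auto simp: ecf_expansion_iff_tail)
qed simp

text \<open>Rationality and the range \<open>[0,1]\<close> are automatic for values of expansions, so membership in a
  level is only a question of the digit sum.\<close>
lemma mem_ecf_level_iff:
  "x \<in> ecf_level k \<longleftrightarrow>
     (\<exists>ts. ecf_expansion ts \<and> ecf_val ts = x \<and> sum_list (map snd ts) \<le> 2 * k + 1)"
  unfolding ecf_level_def using ecf_val_rational ecf_val_expansion_range by auto

lemma ecf_levelI:
  assumes "ecf_expansion ts" "ecf_val ts = x" "sum_list (map snd ts) \<le> 2 * k + 1"
  shows "x \<in> ecf_level k"
  using assms mem_ecf_level_iff by blast

lemma ecf_level_subset: "ecf_level k \<subseteq> {0..1}"
  by (auto simp: ecf_level_def)

lemma ecf_level_mono:
  assumes "m \<le> n"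
  shows "ecf_level m \<subseteq> ecf_level n"
  unfolding ecf_level_def using assms by fastforce

lemma zero_in_ecf_level: "0 \<in> ecf_level k"
  by (rule ecf_levelI[of "[]"]) (auto simp: ecf_expansion_Nil)

lemma one_in_ecf_level: "1 \<in> ecf_level k"
  by (rule ecf_levelI[of "[(1, 1)]"]) (auto simp: ecf_expansion_Cons)

lemma ecf_level_0: "ecf_level 0 = {0, 1}"
proof -
  have "x = 0 \<or> x = 1" if x: "x \<in> ecf_level 0" for x
  proof -
    obtain ts where ts: "ecf_expansion ts" "ecf_val ts = x" "sum_list (map snd ts) \<le> 1"
      using x by (auto simp: mem_ecf_level_iff)
    show ?thesis
    proof (cases ts)
      case (Cons p us)
      then obtain e a where "p = (e, a)" by (cases p)
      then show ?thesis
        using Cons ts by (auto simp: ecf_expansion_Cons elim!: evenE)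
    qed (use ts in auto)
  qed
  then show ?thesis using zero_in_ecf_level one_in_ecf_level by auto
qed

lemma F_E_mid:
  assumes "1/3 \<le> x" "x \<le> 1/2"
  shows "F_E x = 1 / x - 2"
proof (cases "x = 1/3")
  case True
  show ?thesis unfolding True F_E_def by simp
qed (use assms in \<open>simp add: F_E_def\<close>)

lemma F_E_right:
  assumes "1/2 \<le> x"
  shows "F_E x = 2 - 1 / x"
proof (cases "x = 1/2")
  case True
  show ?thesis unfolding True F_E_def by simp
qed (use assms in \<open>simp add: F_E_def\<close>)

text \<open>\<^term>\<open>F_E\<close> acts on expansions by deleting \<open>2\<close> from the first partial quotient. If the quotient is
  at least \<open>4\<close>, it becomes \<open>a\<^sub>1 - 2\<close>. If it equals \<open>2\<close>, the term disappears, and the sign of the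
  next term decides whether \<open>x\<close> lies on the middle branch (sign \<open>1\<close>) or on the right one (sign
  \<open>-1\<close>, which is then flipped to \<open>1\<close>).\<close>
lemma F_E_in_ecf_level:
  assumes x: "x \<in> ecf_level (Suc n)"
  shows "F_E x \<in> ecf_level n"
proof -
  obtain ts where ts: "ecf_expansion ts" "ecf_val ts = x" "sum_list (map snd ts) \<le> 2 * n + 3"
    using x by (auto simp: mem_ecf_level_iff)
  show ?thesis
  proof (cases ts)
    case Nil
    then have "F_E x = 0" using ts by (simp add: F_E_def)
    then show ?thesis by (simp add: zero_in_ecf_level)
  next
    case (Cons p us)
    then obtain a where tsC: "ts = (1, a) # us"
      using ts by (cases p) (auto simp: ecf_expansion_Cons)
    have us: "ecf_tail us" and a: "even a \<and> a > 0 \<or> us = [] \<and> a = 1"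
      using ts tsC by (auto simp: ecf_expansion_Cons)
    have v: "-1 < ecf_val us" "ecf_val us \<le> 1" using ecf_val_tail_bounds[OF us] by auto
    have xv: "x = 1 / (real a + ecf_val us)" using ts tsC by simp
    have "a = 2 \<or> a \<ge> 4" if "even a" "a > 0" using that by presburger
    with a consider "even a" "a \<ge> 4" | "a = 2" | "a = 1" "us = []" by blast
    then show ?thesis
    proof cases
      case 1
      then have "real a \<ge> 4" by simp
      then have Fx: "F_E x = 1 / (real a - 2 + ecf_val us)"
        using v by (auto simp: F_E_def xv field_simps)
      show ?thesis
        using 1 us ts tsC Fx
        by (intro ecf_levelI[of "(1, a - 2) # us"]) (auto simp: ecf_expansion_Cons of_nat_diff)
    next
      case 2
      show ?thesis
      proof (cases us)
        case Nil
        then have "F_E x = 0" unfolding xv using 2 by (simp add: F_E_def)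
        then show ?thesis by (simp add: zero_in_ecf_level)
      next
        case (Cons q ws)
        moreover obtain e b where "q = (e, b)" by (cases q)
        ultimately have usC: "us = (e, b) # ws" by simp
        then have "e = 1 \<or> e = -1" using us by auto
        then show ?thesis
        proof
          assume e: "e = 1"
          then have "ecf_val us > 0" using us usC ecf_val_Cons_pos by auto
          then have "F_E x = ecf_val us"
            using v 2 by (auto simp: F_E_def xv field_simps)
          then show ?thesis
            using us usC e ts tsC 2
            by (intro ecf_levelI[of us]) (auto simp: ecf_expansion_Cons)
        next
          assume e: "e = -1"
          have tail: "ecf_tail ((1, b) # ws)" using us usC e by auto
          have neg: "ecf_val us = - ecf_val ((1, b) # ws)" using usC e by simp
          then have "ecf_val us < 0" using ecf_val_Cons_pos[OF tail] by simp
          then have "1/2 \<le> x" using v 2 by (simp add: xv field_simps)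
          then have "F_E x = 2 - 1 / x" by (rule F_E_right)
          also have "\<dots> = ecf_val ((1, b) # ws)" using 2 neg by (simp add: xv)
          finally have "F_E x = ecf_val ((1, b) # ws)" .
          then show ?thesis
            using us usC e ts tsC 2 tail
            by (intro ecf_levelI[of "(1, b) # ws"]) (auto simp: ecf_expansion_Cons)
        qed
      qed
    next
      case 3
      then have "F_E x = 1" unfolding xv by (simp add: F_E_def)
      then show ?thesis by (simp add: one_in_ecf_level)
    qed
  qed
qed

definition F_E_inv_left :: "real \<Rightarrow> real" where "F_E_inv_left z = z / (1 + 2 * z)"
definition F_E_inv_mid :: "real \<Rightarrow> real" where "F_E_inv_mid z = 1 / (2 + z)"
definition F_E_inv_right :: "real \<Rightarrow> real" where "F_E_inv_right z = 1 / (2 - z)"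

lemma inverse_branches_F_E:
  "0 \<le> x \<Longrightarrow> x \<le> 1/3 \<Longrightarrow> F_E_inv_left (F_E x) = x"
  "1/3 \<le> x \<Longrightarrow> x \<le> 1/2 \<Longrightarrow> F_E_inv_mid (F_E x) = x"
  "1/2 \<le> x \<Longrightarrow> x \<le> 1 \<Longrightarrow> F_E_inv_right (F_E x) = x"
proof -
  show "F_E_inv_left (F_E x) = x" if "0 \<le> x" "x \<le> 1/3"
  proof -
    have "1 - 2 * x > 0" using that by simp
    then show ?thesis using that by (simp add: F_E_def F_E_inv_left_def field_simps)
  qed
  show "F_E_inv_mid (F_E x) = x" if "1/3 \<le> x" "x \<le> 1/2"
    using that by (simp add: F_E_mid F_E_inv_mid_def)
  show "F_E_inv_right (F_E x) = x" if "1/2 \<le> x" "x \<le> 1"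
    using that by (simp add: F_E_right F_E_inv_right_def)
qed

text \<open>The inverse branches insert a \<open>2\<close>: into the first partial quotient, as a new term followed by the
  old sign, or as a new term followed by the opposite sign. The expansions of \<open>0\<close> and \<open>1\<close> need
  separate treatment, since they have no even first quotient.\<close>
lemma inverse_branches_in_ecf_level:
  assumes z: "z \<in> ecf_level n"
  shows "F_E_inv_left z \<in> ecf_level (Suc n)" "F_E_inv_mid z \<in> ecf_level (Suc n)"
    "F_E_inv_right z \<in> ecf_level (Suc n)"
proof -
  obtain ts where ts: "ecf_expansion ts" "ecf_val ts = z" "sum_list (map snd ts) \<le> 2 * n + 1"
    using z by (auto simp: mem_ecf_level_iff)
  show "F_E_inv_mid z \<in> ecf_level (Suc n)"
    using ts by (intro ecf_levelI[of "(1, 2) # ts"])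
      (auto simp: F_E_inv_mid_def ecf_expansion_Cons ecf_expansion_iff_tail)
  have "F_E_inv_left z \<in> ecf_level (Suc n) \<and> F_E_inv_right z \<in> ecf_level (Suc n)"
  proof (cases ts)
    case Nil
    then have "z = 0" using ts by simp
    moreover have "1/2 \<in> ecf_level (Suc n)"
      by (rule ecf_levelI[of "[(1, 2)]"]) (auto simp: ecf_expansion_Cons)
    ultimately show ?thesis by (simp add: F_E_inv_left_def F_E_inv_right_def zero_in_ecf_level)
  next
    case (Cons p us)
    then obtain a where tsC: "ts = (1, a) # us"
      using ts by (cases p) (auto simp: ecf_expansion_Cons)
    have us: "ecf_tail us" and a: "even a \<and> a > 0 \<or> us = [] \<and> a = 1"
      using ts tsC by (auto simp: ecf_expansion_Cons)
    show ?thesis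
    proof (cases "even a \<and> a > 0")
      case True
      have v: "-1 < ecf_val us" using ecf_val_tail_bounds[OF us] by auto
      have "real a \<ge> 2" using True by (auto elim!: evenE)
      then have pos: "real a + ecf_val us > 1" using v by simp
      have zv: "z = 1 / (real a + ecf_val us)" using ts tsC by simp
      have "F_E_inv_left z = ecf_val ((1, a + 2) # us)"
        using pos by (simp add: F_E_inv_left_def zv field_simps)
      moreover have "F_E_inv_right z = ecf_val ((1, 2) # (-1, a) # us)"
        by (simp add: F_E_inv_right_def zv)
      ultimately show ?thesis
        using ts tsC us True
        by (intro conjI ecf_levelI[of "(1, a + 2) # us"] ecf_levelI[of "(1, 2) # (-1, a) # us"])
          (auto simp: ecf_expansion_Cons)
    next
      case False
      then have "z = 1" using a ts tsC by auto
      moreover have "1/3 \<in> ecf_level (Suc n)"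
        by (rule ecf_levelI[of "[(1, 2), (1, 1)]"]) (auto simp: ecf_expansion_Cons)
      ultimately show ?thesis by (simp add: F_E_inv_left_def F_E_inv_right_def one_in_ecf_level)
    qed
  qed
  then show "F_E_inv_left z \<in> ecf_level (Suc n)" "F_E_inv_right z \<in> ecf_level (Suc n)" by auto
qed

lemma ecf_level_Suc_iff:
  assumes x: "x \<in> {0..1}"
  shows "x \<in> ecf_level (Suc n) \<longleftrightarrow> F_E x \<in> ecf_level n"
proof
  assume F: "F_E x \<in> ecf_level n"
  consider "0 \<le> x" "x \<le> 1/3" | "1/3 \<le> x" "x \<le> 1/2" | "1/2 \<le> x" "x \<le> 1"
    using x by fastforce
  then show "x \<in> ecf_level (Suc n)"
    using inverse_branches_in_ecf_level[OF F] inverse_branches_F_E[of x] by cases simp_all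
qed (rule F_E_in_ecf_level)

lemma finite_ecf_level: "finite (ecf_level n)"
proof (induction n)
  case (Suc n)
  have "x \<in> F_E_inv_left ` ecf_level n \<union> F_E_inv_mid ` ecf_level n \<union> F_E_inv_right ` ecf_level n"
    if x: "x \<in> ecf_level (Suc n)" for x
  proof -
    have F: "F_E x \<in> ecf_level n" using x by (rule F_E_in_ecf_level)
    have "0 \<le> x" "x \<le> 1" using x ecf_level_subset by fastforce+
    then consider "0 \<le> x" "x \<le> 1/3" | "1/3 \<le> x" "x \<le> 1/2" | "1/2 \<le> x" "x \<le> 1"
      by fastforce
    then show ?thesis
      using F by cases (metis UnI1 UnI2 image_eqI inverse_branches_F_E)+
  qed
  then show ?case using Suc by (meson finite_UnI finite_imageI finite_subset subsetI)
qed (simp add: ecf_level_0)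

lemma F_E_range:
  assumes "x \<in> {0..1}"
  shows "F_E x \<in> {0..1}"
  using assms by (auto simp: F_E_def field_simps)

text \<open>\<^term>\<open>F_E\<close> sends \<open>p/q\<close> to \<open>p/(q-2p)\<close>, \<open>(q-2p)/p\<close> or \<open>(2p-q)/p\<close>. For \<open>0 < p < q\<close> each of these has
  a smaller denominator, in lowest terms or not, so the orbit of a rational ends in \<open>{0,1}\<close>.\<close>
lemma rational_in_ecf_level:
  assumes "p \<le> q" "q > 0"
  shows "\<exists>n. real p / real q \<in> ecf_level n"
  using assms
proof (induction q arbitrary: p rule: less_induct)
  case (less q)
  have x: "real p / real q \<in> {0..1}" using less.prems by simp
  have step: "\<exists>n. real p / real q \<in> ecf_level n"
    if red: "F_E (real p / real q) = real p' / real q'" "q' < q" "p' \<le> q'" "0 < q'" for p' q'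
  proof -
    obtain n where "real p' / real q' \<in> ecf_level n" using less.IH[OF red(2-4)] by blast
    then show ?thesis using ecf_level_Suc_iff[OF x] red(1) by metis
  qed
  consider "p = 0" | "p = q" | "0 < p" "3 * p \<le> q" | "q < 3 * p" "2 * p \<le> q"
    | "q < 2 * p" "p < q" using less.prems by linarith
  then show ?case
  proof cases
    case 3
    then have "F_E (real p / real q) = real p / real (q - 2 * p)"
      by (simp add: F_E_def field_simps of_nat_diff)
    then show ?thesis by (rule step) (use 3 in auto)
  next
    case 4
    then have "F_E (real p / real q) = real (q - 2 * p) / real p"
      by (simp add: F_E_def field_simps of_nat_diff)
    then show ?thesis by (rule step) (use 4 less.prems in auto)
  next
    case 5
    then have "F_E (real p / real q) = real (2 * p - q) / real p"
      by (simp add: F_E_def field_simps of_nat_diff)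
    then show ?thesis by (rule step) (use 5 in auto)
  qed (use less.prems zero_in_ecf_level one_in_ecf_level in auto)
qed

section \<open>Counting the elements of a level\<close>

text \<open>On each branch \<^term>\<open>F_E\<close> is a monotone bijection from the points of level \<open>n + 1\<close> in the
  interval of that branch to the points of level \<open>n\<close>. The middle branch reverses the order.\<close>
lemma card_level_left:
  assumes x: "0 \<le> x" "x \<le> 1/3"
  shows "card {y \<in> ecf_level (Suc n). y < x} = card {z \<in> ecf_level n. z < F_E x}"
proof (rule bij_betw_same_card[of F_E], rule bij_betw_byWitness[where f' = F_E_inv_left])
  show "\<forall>y\<in>{y \<in> ecf_level (Suc n). y < x}. F_E_inv_left (F_E y) = y"
    using x ecf_level_subset inverse_branches_F_E(1) by fastforce
  have FG: "F_E (F_E_inv_left z) = z \<and> F_E_inv_left z < x" if z: "z \<in> ecf_level n" "z < F_E x" for z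
  proof -
    have z01: "0 \<le> z" "z \<le> 1" using z ecf_level_subset by fastforce+
    have "F_E_inv_left z \<le> 1/3" using z01 by (simp add: F_E_inv_left_def field_simps)
    then have "F_E (F_E_inv_left z) = z" using z01 by (simp add: F_E_def F_E_inv_left_def field_simps)
    moreover have "F_E_inv_left z < x"
    proof -
      have "1 - 2 * x > 0" using x by simp
      then show ?thesis using x z(2) z01 by (simp add: F_E_def F_E_inv_left_def field_simps)
    qed
    ultimately show ?thesis by simp
  qed
  then show "\<forall>z\<in>{z \<in> ecf_level n. z < F_E x}. F_E (F_E_inv_left z) = z" by simp
  show "F_E_inv_left ` {z \<in> ecf_level n. z < F_E x} \<subseteq> {y \<in> ecf_level (Suc n). y < x}"
    using FG inverse_branches_in_ecf_level by auto
  show "F_E ` {y \<in> ecf_level (Suc n). y < x} \<subseteq> {z \<in> ecf_level n. z < F_E x}"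
  proof safe
    fix y assume y: "y \<in> ecf_level (Suc n)" "y < x"
    then show "F_E y \<in> ecf_level n" by (simp add: F_E_in_ecf_level)
    have "1 - 2 * x > 0" "1 - 2 * y > 0" using x y by simp_all
    then show "F_E y < F_E x" using x y by (simp add: F_E_def field_simps)
  qed
qed

lemma card_level_mid:
  assumes x: "1/3 \<le> x" "x \<le> 1/2"
  shows "card {y \<in> ecf_level (Suc n). 1/3 \<le> y \<and> y < x} = card {z \<in> ecf_level n. z > F_E x}"
proof (rule bij_betw_same_card[of F_E], rule bij_betw_byWitness[where f' = F_E_inv_mid])
  show "\<forall>y\<in>{y \<in> ecf_level (Suc n). 1/3 \<le> y \<and> y < x}. F_E_inv_mid (F_E y) = y"
    using x inverse_branches_F_E(2) by auto
  have FG: "F_E (F_E_inv_mid z) = z \<and> 1/3 \<le> F_E_inv_mid z \<and> F_E_inv_mid z < x"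
    if z: "z \<in> ecf_level n" "z > F_E x" for z
  proof -
    have z01: "0 \<le> z" "z \<le> 1" using z ecf_level_subset by fastforce+
    have "1/3 \<le> F_E_inv_mid z" "F_E_inv_mid z \<le> 1/2" using z01 by (simp_all add: F_E_inv_mid_def field_simps)
    then have "F_E (F_E_inv_mid z) = z" using F_E_mid by (simp add: F_E_inv_mid_def)
    moreover have "F_E_inv_mid z < x"
      using x z(2) z01 F_E_mid[of x] by (simp add: F_E_inv_mid_def field_simps)
    ultimately show ?thesis using \<open>1/3 \<le> F_E_inv_mid z\<close> by simp
  qed
  then show "\<forall>z\<in>{z \<in> ecf_level n. z > F_E x}. F_E (F_E_inv_mid z) = z" by simp
  show "F_E_inv_mid ` {z \<in> ecf_level n. z > F_E x} \<subseteq> {y \<in> ecf_level (Suc n). 1/3 \<le> y \<and> y < x}"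
    using FG inverse_branches_in_ecf_level by auto
  show "F_E ` {y \<in> ecf_level (Suc n). 1/3 \<le> y \<and> y < x} \<subseteq> {z \<in> ecf_level n. z > F_E x}"
  proof safe
    fix y assume y: "y \<in> ecf_level (Suc n)" "1/3 \<le> y" "y < x"
    then show "F_E y \<in> ecf_level n" by (simp add: F_E_in_ecf_level)
    show "F_E y > F_E x" using x y by (simp add: F_E_mid field_simps)
  qed
qed

lemma card_level_right:
  assumes x: "1/2 \<le> x" "x \<le> 1"
  shows "card {y \<in> ecf_level (Suc n). 1/2 \<le> y \<and> y < x} = card {z \<in> ecf_level n. z < F_E x}"
proof (rule bij_betw_same_card[of F_E], rule bij_betw_byWitness[where f' = F_E_inv_right])
  show "\<forall>y\<in>{y \<in> ecf_level (Suc n). 1/2 \<le> y \<and> y < x}. F_E_inv_right (F_E y) = y"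
    using x inverse_branches_F_E(3) by auto
  have FG: "F_E (F_E_inv_right z) = z \<and> 1/2 \<le> F_E_inv_right z \<and> F_E_inv_right z < x"
    if z: "z \<in> ecf_level n" "z < F_E x" for z
  proof -
    have z01: "0 \<le> z" "z \<le> 1" using z ecf_level_subset by fastforce+
    have "1/2 \<le> F_E_inv_right z" using z01 by (simp add: F_E_inv_right_def field_simps)
    then have "F_E (F_E_inv_right z) = z" using F_E_right by (simp add: F_E_inv_right_def)
    moreover have "F_E_inv_right z < x"
      using x z(2) z01 F_E_right[of x] by (simp add: F_E_inv_right_def field_simps)
    ultimately show ?thesis using \<open>1/2 \<le> F_E_inv_right z\<close> by simp
  qed
  then show "\<forall>z\<in>{z \<in> ecf_level n. z < F_E x}. F_E (F_E_inv_right z) = z" by simp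
  show "F_E_inv_right ` {z \<in> ecf_level n. z < F_E x} \<subseteq> {y \<in> ecf_level (Suc n). 1/2 \<le> y \<and> y < x}"
    using FG inverse_branches_in_ecf_level by auto
  show "F_E ` {y \<in> ecf_level (Suc n). 1/2 \<le> y \<and> y < x} \<subseteq> {z \<in> ecf_level n. z < F_E x}"
  proof safe
    fix y assume y: "y \<in> ecf_level (Suc n)" "1/2 \<le> y" "y < x"
    then show "F_E y \<in> ecf_level n" by (simp add: F_E_in_ecf_level)
    show "F_E y < F_E x" using x y by (simp add: F_E_right field_simps)
  qed
qed

lemma card_level_split:
  assumes "c \<le> x"
  shows "card {y \<in> ecf_level n. y < x} =
    card {y \<in> ecf_level n. y < c} + card {y \<in> ecf_level n. c \<le> y \<and> y < x}"
proof -
  have "{y \<in> ecf_level n. y < x} = {y \<in> ecf_level n. y < c} \<union> {y \<in> ecf_level n. c \<le> y \<and> y < x}"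
    using assms by auto
  also have "card \<dots> = card {y \<in> ecf_level n. y < c} + card {y \<in> ecf_level n. c \<le> y \<and> y < x}"
    by (rule card_Un_disjoint) (auto simp: finite_ecf_level)
  finally show ?thesis .
qed

lemma F_E_breakpoints: "F_E 0 = 0" "F_E (1/3) = 1" "F_E (1/2) = 0" "F_E 1 = 1"
  by (simp_all add: F_E_def)

lemma card_level_pos: "card {z \<in> ecf_level n. z > 0} = card (ecf_level n) - 1"
proof -
  have "{z \<in> ecf_level n. z > 0} = ecf_level n - {0}" using ecf_level_subset by fastforce
  then show ?thesis using zero_in_ecf_level by (simp add: finite_ecf_level)
qed

lemma card_level_less_1: "card {z \<in> ecf_level n. z < 1} = card (ecf_level n) - 1"
proof -
  have "{z \<in> ecf_level n. z < 1} = ecf_level n - {1}" using ecf_level_subset by fastforce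
  then show ?thesis using one_in_ecf_level by (simp add: finite_ecf_level)
qed

lemma card_level_half:
  "card {y \<in> ecf_level (Suc n). y < 1/2} = 2 * (card (ecf_level n) - 1)"
  using card_level_split[of "1/3" "1/2" "Suc n"] card_level_left[of "1/3" n]
    card_level_mid[of "1/2" n]
  by (simp add: F_E_breakpoints card_level_pos card_level_less_1)

text \<open>The count \<open>3\<^sup>n\<close> of points other than \<open>1\<close> triples, because the half-open branch intervals
  \<open>[0,1/3)\<close>, \<open>[1/3,1/2)\<close> and \<open>[1/2,1)\<close> contribute the points of level \<open>n\<close> without \<open>1\<close>, without
  \<open>0\<close>, and without \<open>1\<close>.\<close>
lemma card_ecf_level: "card (ecf_level n) = 3 ^ n + 1"
proof (induction n)
  case (Suc n)
  have "card (ecf_level (Suc n)) - 1 = 3 * (card (ecf_level n) - 1)"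
    using card_level_split[of "1/2" 1 "Suc n"] card_level_right[of 1 n] card_level_half[of n]
    by (simp add: F_E_breakpoints card_level_less_1)
  moreover have "card (ecf_level (Suc n)) > 0"
    using zero_in_ecf_level finite_ecf_level by (auto simp: card_gt_0_iff)
  ultimately show ?case using Suc by simp
qed (simp add: ecf_level_0)

definition Q_approx :: "nat \<Rightarrow> real \<Rightarrow> real" where
  "Q_approx n x = real (card {y \<in> ecf_level n. y < x}) / 3 ^ n"

text \<open>The preimage of \<open>t\<close> under the branch of \<^term>\<open>F_E_bar\<close> that corresponds to the branch of
  \<^term>\<open>F_E\<close> on which \<open>x\<close> lies.\<close>
definition F_E_bar_lift :: "real \<Rightarrow> real \<Rightarrow> real" where
  "F_E_bar_lift x t = (if x \<le> 1/3 then t / 3 else if x \<le> 1/2 then 2/3 - t / 3 else 2/3 + t / 3)"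

lemma card_level_greater:
  "card {z \<in> ecf_level n. z > c} + card {z \<in> ecf_level n. z < c} + (if c \<in> ecf_level n then 1 else 0)
     = 3 ^ n + 1"
proof -
  let ?E = "{z \<in> ecf_level n. z = c}"
  have "ecf_level n = {z \<in> ecf_level n. z > c} \<union> ({z \<in> ecf_level n. z < c} \<union> ?E)" by auto
  then have "3 ^ n + 1 = card ({z \<in> ecf_level n. z > c} \<union> ({z \<in> ecf_level n. z < c} \<union> ?E))"
    using card_ecf_level[of n] by simp
  also have "\<dots> = card {z \<in> ecf_level n. z > c} + card ({z \<in> ecf_level n. z < c} \<union> ?E)"
    by (rule card_Un_disjoint) (auto simp: finite_ecf_level)
  also have "card ({z \<in> ecf_level n. z < c} \<union> ?E) = card {z \<in> ecf_level n. z < c} + card ?E"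
    by (rule card_Un_disjoint) (auto simp: finite_ecf_level)
  also have "card ?E = (if c \<in> ecf_level n then 1 else 0)"
  proof -
    have "?E = (if c \<in> ecf_level n then {c} else {})" by auto
    then show ?thesis by simp
  qed
  finally show ?thesis by simp
qed

text \<open>An orientation-reversing branch turns \<open>y < x\<close> into \<open>z > F_E x\<close>, and the complement of \<open>z > F_E x\<close>
  includes \<open>z = F_E x\<close>. This is the source of the error term, which vanishes when \<open>F_E x\<close>
  belongs to level \<open>n\<close>.\<close>
lemma Q_approx_Suc:
  assumes x: "x \<in> {0..1}"
  shows "Q_approx (Suc n) x = F_E_bar_lift x (Q_approx n (F_E x)) +
    (if 1/3 < x \<and> x \<le> 1/2 \<and> F_E x \<notin> ecf_level n then 1 / 3 ^ Suc n else 0)"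
proof -
  consider "0 \<le> x" "x \<le> 1/3" | "1/3 < x" "x \<le> 1/2" | "1/2 < x" "x \<le> 1"
    using x by fastforce
  then show ?thesis
  proof cases
    case 1
    then show ?thesis by (simp add: Q_approx_def F_E_bar_lift_def card_level_left)
  next
    case 2
    have "card {y \<in> ecf_level (Suc n). y < x} = 3 ^ n + card {z \<in> ecf_level n. z > F_E x}"
      using card_level_split[of "1/3" x "Suc n"] card_level_left[of "1/3" n]
        card_level_mid[of x n] 2
      by (simp add: F_E_breakpoints card_level_less_1 card_ecf_level)
    then have "card {y \<in> ecf_level (Suc n). y < x} + card {z \<in> ecf_level n. z < F_E x}
        + (if F_E x \<in> ecf_level n then 1 else 0) = 2 * 3 ^ n + 1"
      using card_level_greater[of n "F_E x"] by simp
    then have "real (card {y \<in> ecf_level (Suc n). y < x}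
        + card {z \<in> ecf_level n. z < F_E x} + (if F_E x \<in> ecf_level n then 1 else 0))
        = 2 * 3 ^ n + 1"
      by simp
    then have "real (card {y \<in> ecf_level (Suc n). y < x}) =
        2 * 3 ^ n - real (card {z \<in> ecf_level n. z < F_E x})
        + (if F_E x \<in> ecf_level n then 0 else 1)"
      by (simp split: if_splits)
    then show ?thesis
      using 2 by (simp add: Q_approx_def F_E_bar_lift_def field_simps)
  next
    case 3
    have "card {y \<in> ecf_level (Suc n). y < x} = 2 * 3 ^ n + card {z \<in> ecf_level n. z < F_E x}"
      using card_level_split[of "1/2" x "Suc n"] card_level_half[of n] card_level_right[of x n] 3
      by (simp add: card_ecf_level)
    then show ?thesis
      using 3 by (simp add: Q_approx_def F_E_bar_lift_def field_simps)
  qed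
qed

section \<open>The limit of the counting functions\<close>

text \<open>Continuous approximations to \<^term>\<open>Q_E\<close>: they obey the recursion of the counting functions without
  the error term and start from the identity instead of a step function.\<close>
primrec Q_iterate :: "nat \<Rightarrow> real \<Rightarrow> real" where
  "Q_iterate 0 x = x"
| "Q_iterate (Suc n) x = F_E_bar_lift x (Q_iterate n (F_E x))"

lemma F_E_bar_lift_contract: "\<bar>F_E_bar_lift x s - F_E_bar_lift x t\<bar> = \<bar>s - t\<bar> / 3"
  by (auto simp: F_E_bar_lift_def abs_if)

lemma Q_iterate_range:
  assumes "x \<in> {0..1}"
  shows "Q_iterate n x \<in> {0..1}"
  using assms
proof (induction n arbitrary: x)
  case (Suc n)
  then have "Q_iterate n (F_E x) \<in> {0..1}" using F_E_range by blast
  then show ?case by (auto simp: F_E_bar_lift_def)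
qed simp

lemma Q_iterate_fixed: "Q_iterate n 0 = 0" "Q_iterate n 1 = 1"
  by (induction n) (simp_all add: F_E_bar_lift_def F_E_breakpoints)

text \<open>For \<open>n = 0\<close> both iterates lie in \<open>[0,1]\<close>; each further application of the recursion divides
  their distance by \<open>3\<close>.\<close>
lemma Q_iterate_Cauchy:
  assumes "x \<in> {0..1}"
  shows "\<bar>Q_iterate (n + k) x - Q_iterate n x\<bar> \<le> 1 / 3 ^ n"
  using assms
proof (induction n arbitrary: x)
  case 0
  then show ?case using Q_iterate_range[of x k] by (simp add: abs_le_iff)
next
  case (Suc n)
  have "\<bar>Q_iterate (n + k) (F_E x) - Q_iterate n (F_E x)\<bar> \<le> 1 / 3 ^ n"
    using Suc F_E_range by blast
  then show ?case by (simp add: F_E_bar_lift_contract)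
qed

text \<open>Each step divides the previous difference by \<open>3\<close> and adds at most \<open>3\<^sup>-\<^sup>n\<^sup>-\<^sup>1\<close>, so that the
  difference at step \<open>n\<close> is at most \<open>n + 1\<close> times \<open>3\<^sup>-\<^sup>n\<close>.\<close>
lemma Q_approx_near_iterate:
  assumes "x \<in> {0..1}"
  shows "\<bar>Q_approx n x - Q_iterate n x\<bar> \<le> (real n + 1) / 3 ^ n"
  using assms
proof (induction n arbitrary: x)
  case 0
  have "{y \<in> ecf_level 0. y < x} = (if x = 0 then {} else {0})"
    using 0 by (auto simp: ecf_level_0)
  then show ?case using 0 by (auto simp: Q_approx_def)
next
  case (Suc n)
  let ?d = "Q_approx (Suc n) x - F_E_bar_lift x (Q_approx n (F_E x))"
  have "\<bar>Q_approx n (F_E x) - Q_iterate n (F_E x)\<bar> \<le> (real n + 1) / 3 ^ n"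
    using Suc F_E_range by blast
  then have "\<bar>F_E_bar_lift x (Q_approx n (F_E x)) - Q_iterate (Suc n) x\<bar>
      \<le> (real n + 1) / 3 ^ n / 3"
    unfolding Q_iterate.simps F_E_bar_lift_contract by (rule divide_right_mono) simp
  moreover have "\<bar>?d\<bar> \<le> 1 / 3 ^ Suc n"
    using Q_approx_Suc[OF Suc.prems, of n] by (auto simp del: power_Suc)
  ultimately have "\<bar>Q_approx (Suc n) x - Q_iterate (Suc n) x\<bar>
      \<le> (real n + 1) / 3 ^ n / 3 + 1 / 3 ^ Suc n" by linarith
  also have "\<dots> = (real (Suc n) + 1) / 3 ^ Suc n" by (simp add: field_simps)
  finally show ?case .
qed

lemma continuous_on_F_E: "continuous_on {0..1} F_E"
  unfolding F_E_def
  \<comment> \<open>Substituting the breakpoint turns the agreement of adjacent branches into arithmetic.\<close>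
  by (intro continuous_on_cases_le continuous_intros ballI impI; (hypsubst, simp)?; force?)

text \<open>The formulas of \<^term>\<open>F_E_bar_lift\<close> agree at \<open>x = 1/3\<close> and at \<open>x = 1/2\<close> because \<open>F_E x\<close> is \<open>1\<close> and
  \<open>0\<close> there, and these values are fixed by every iterate.\<close>
lemma continuous_on_Q_iterate: "continuous_on {0..1} (Q_iterate n)"
proof (induction n)
  case 0
  then show ?case by (simp add: continuous_on_id[unfolded id_def] cong: continuous_on_cong)
next
  case (Suc n)
  have C: "continuous_on {0..1} (\<lambda>x. Q_iterate n (F_E x))"
    using continuous_on_compose2[OF Suc continuous_on_F_E] F_E_range by blast
  have "continuous_on {0..1} (\<lambda>x. F_E_bar_lift x (Q_iterate n (F_E x)))"
    unfolding F_E_bar_lift_def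
    by (intro continuous_on_cases_le continuous_intros continuous_on_subset[OF C] ballI impI;
      (hypsubst, simp add: F_E_breakpoints Q_iterate_fixed)?; force?)
  then show ?case by simp
qed

lemma uniform_limit_Q_iterate: "\<exists>Q. uniform_limit {0..1} Q_iterate Q sequentially"
proof -
  have "uniformly_Cauchy_on {0..1} Q_iterate"
    unfolding uniformly_Cauchy_on_def
  proof (intro allI impI)
    fix e :: real assume "e > 0"
    then obtain M where "(1/3) ^ M < e/2"
      using real_arch_pow_inv[of "e/2" "1/3"] by auto
    then have M: "1 / 3 ^ M < e/2" by (simp add: power_one_over)
    have "dist (Q_iterate m x) (Q_iterate n x) < e"
      if "x \<in> {0..1}" "M \<le> m" "M \<le> n" for x m n
    proof -
      have "\<bar>Q_iterate m x - Q_iterate M x\<bar> \<le> 1 / 3 ^ M" "\<bar>Q_iterate n x - Q_iterate M x\<bar> \<le> 1 / 3 ^ M"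
        using Q_iterate_Cauchy[of x M "m - M"] Q_iterate_Cauchy[of x M "n - M"] that by simp_all
      then show ?thesis using M unfolding dist_real_def by linarith
    qed
    then show "\<exists>M. \<forall>x\<in>{0..1}. \<forall>m\<ge>M. \<forall>n\<ge>M. dist (Q_iterate m x) (Q_iterate n x) < e"
      by blast
  qed
  then show ?thesis
    using Cauchy_uniformly_convergent uniformly_convergent_on_def by blast
qed

lemma Q_approx_limit:
  assumes x: "x \<in> {0..1}" and L: "(\<lambda>n. Q_iterate n x) \<longlonglongrightarrow> L"
  shows "(\<lambda>n. Q_approx n x) \<longlonglongrightarrow> L"
proof -
  have "(\<lambda>n. real n * (1/3) ^ n + (1/3) ^ n) \<longlonglongrightarrow> 0 + 0"
    by (intro tendsto_add powser_times_n_limit_0 LIMSEQ_power_zero) auto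
  then have "(\<lambda>n. (real n + 1) / 3 ^ n) \<longlonglongrightarrow> 0"
    by (simp add: power_one_over field_simps)
  then have "(\<lambda>n. Q_approx n x - Q_iterate n x) \<longlonglongrightarrow> 0"
    by (rule Lim_null_comparison[rotated]) (use Q_approx_near_iterate[OF x] in auto)
  from tendsto_add[OF this L] show ?thesis by simp
qed

lemma Q_E_eq_lim: "Q_E x = lim (\<lambda>n. Q_approx n x)"
  by (simp add: Q_E_def Q_approx_def)

lemma uniform_limit_Q_E: "uniform_limit {0..1} Q_iterate Q_E sequentially"
proof -
  obtain Q where Q: "uniform_limit {0..1} Q_iterate Q sequentially"
    using uniform_limit_Q_iterate by blast
  have "Q x = Q_E x" if x: "x \<in> {0..1}" for x
    using Q_approx_limit[OF x tendsto_uniform_limitI[OF Q x]]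
    by (simp add: Q_E_eq_lim limI)
  then show ?thesis
    using Q uniform_limit_cong'[of "{0..1}" Q_iterate Q_iterate Q Q_E sequentially] by blast
qed

lemma Q_iterate_tendsto: "x \<in> {0..1} \<Longrightarrow> (\<lambda>n. Q_iterate n x) \<longlonglongrightarrow> Q_E x"
  by (rule tendsto_uniform_limitI[OF uniform_limit_Q_E])

lemma continuous_on_Q_E: "continuous_on {0..1} Q_E"
  by (rule uniform_limit_theorem[OF _ uniform_limit_Q_E])
    (simp_all add: continuous_on_Q_iterate)

lemma Q_E_functional_equation:
  assumes x: "x \<in> {0..1}"
  shows "Q_E x = F_E_bar_lift x (Q_E (F_E x))"
proof -
  have "(\<lambda>n. Q_iterate n (F_E x)) \<longlonglongrightarrow> Q_E (F_E x)"
    using Q_iterate_tendsto F_E_range[OF x] by blast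
  then have "(\<lambda>n. Q_iterate (Suc n) x) \<longlonglongrightarrow> F_E_bar_lift x (Q_E (F_E x))"
    by (auto simp: F_E_bar_lift_def intro!: tendsto_intros)
  moreover have "(\<lambda>n. Q_iterate (Suc n) x) \<longlonglongrightarrow> Q_E x"
    using Q_iterate_tendsto[OF x] by (rule LIMSEQ_Suc)
  ultimately show ?thesis using LIMSEQ_unique by blast
qed

lemma Q_E_0: "Q_E 0 = 0"
  using Q_E_functional_equation[of 0] by (simp add: F_E_bar_lift_def F_E_breakpoints)

lemma Q_E_1: "Q_E 1 = 1"
  using Q_E_functional_equation[of 1] by (simp add: F_E_bar_lift_def F_E_breakpoints)

section \<open>Monotonicity\<close>

lemma Q_approx_mono:
  assumes "x \<le> y"
  shows "Q_approx n x \<le> Q_approx n y"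
proof -
  have "card {z \<in> ecf_level n. z < x} \<le> card {z \<in> ecf_level n. z < y}"
    using assms by (intro card_mono) (auto simp: finite_ecf_level)
  then show ?thesis by (simp add: Q_approx_def divide_right_mono)
qed

lemma Q_E_mono:
  assumes "x \<in> {0..1}" "y \<in> {0..1}" "x \<le> y"
  shows "Q_E x \<le> Q_E y"
  using LIMSEQ_le[OF Q_approx_limit[OF _ Q_iterate_tendsto] Q_approx_limit[OF _ Q_iterate_tendsto]]
    Q_approx_mono assms by blast

text \<open>On a level the recursion for the counting functions has no error term and coincides with the
  functional equation of \<^term>\<open>Q_E\<close>.\<close>
lemma Q_E_eq_Q_approx:
  assumes "x \<in> ecf_level n"
  shows "Q_E x = Q_approx n x"
  using assms
proof (induction n arbitrary: x)
  case 0
  then have "x = 0 \<or> x = 1" by (simp add: ecf_level_0)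
  moreover have *: "{y \<in> ecf_level 0. y < 0} = {}" "{y \<in> ecf_level 0. y < 1} = {0}"
    by (auto simp: ecf_level_0)
  have "Q_approx 0 0 = 0" "Q_approx 0 1 = 1"
    unfolding Q_approx_def * by simp_all
  ultimately show ?case using Q_E_0 Q_E_1 by auto
next
  case (Suc n)
  have x: "x \<in> {0..1}" using Suc ecf_level_subset by blast
  have "F_E x \<in> ecf_level n" using Suc F_E_in_ecf_level by blast
  then show ?case
    using Suc.IH Q_approx_Suc[OF x] Q_E_functional_equation[OF x] by simp
qed

lemma rational_between_in_ecf_level:
  assumes "0 \<le> x" "x < y" "y \<le> 1"
  shows "\<exists>r n. x < r \<and> r < y \<and> r \<in> ecf_level n"
proof -
  obtain r where r: "r \<in> \<rat>" "x < r" "r < y" using Rats_dense_in_real assms by blast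
  then obtain p q :: nat where pq: "q \<noteq> 0" "r = real p / real q"
    using Rats_abs_nat_div_natE[of r] assms by (metis abs_of_nonneg less_eq_real_def order_le_less_trans)
  have "r < 1" using r assms by simp
  then have "p \<le> q" using pq by simp
  then show ?thesis using rational_in_ecf_level[of p q] r pq by auto
qed

text \<open>Between \<open>x\<close> and \<open>y\<close> lie two points \<open>r < s\<close> of a common level; there \<^term>\<open>Q_E\<close> is the counting
  function, and \<open>r\<close> itself is counted below \<open>s\<close> but not below \<open>r\<close>.\<close>
lemma Q_E_strict_mono:
  assumes "x \<in> {0..1}" "y \<in> {0..1}" "x < y"
  shows "Q_E x < Q_E y"
proof -
  obtain r m where r: "x < r" "r < y" "r \<in> ecf_level m"
    using rational_between_in_ecf_level[of x y] assms by auto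
  obtain s k where s: "r < s" "s < y" "s \<in> ecf_level k"
    using rational_between_in_ecf_level[of r y] assms r by auto
  define n where "n = max m k"
  have lev: "r \<in> ecf_level n" "s \<in> ecf_level n"
    using r(3) s(3) ecf_level_mono[of m n] ecf_level_mono[of k n] by (auto simp: n_def)
  then have rs: "r \<in> {0..1}" "s \<in> {0..1}" using ecf_level_subset by blast+
  have "card {z \<in> ecf_level n. z < r} < card {z \<in> ecf_level n. z < s}"
    using lev s(1) by (intro psubset_card_mono) (auto simp: finite_ecf_level)
  then have "Q_E r < Q_E s"
    using Q_E_eq_Q_approx lev by (simp add: Q_approx_def divide_strict_right_mono)
  moreover have "Q_E x \<le> Q_E r" "Q_E s \<le> Q_E y"
    using Q_E_mono assms r s rs by (simp_all add: less_imp_le)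
  ultimately show ?thesis by simp
qed

lemma Q_E_range: "x \<in> {0..1} \<Longrightarrow> Q_E x \<in> {0..1}"
  using Q_E_mono[of 0 x] Q_E_mono[of x 1] Q_E_0 Q_E_1 by auto

lemma Q_E_image: "Q_E ` {0..1} = {0..1}"
proof
  show "{0..1} \<subseteq> Q_E ` {0..1}"
  proof
    fix y :: real assume "y \<in> {0..1}"
    then obtain x where "0 \<le> x" "x \<le> 1" "Q_E x = y"
      using IVT'[of Q_E 0 y 1] continuous_on_Q_E by (auto simp: Q_E_0 Q_E_1)
    then show "y \<in> Q_E ` {0..1}" by auto
  qed
qed (use Q_E_range in blast)

lemma inj_on_Q_E: "inj_on Q_E {0..1}"
  by (rule linorder_inj_onI) (use Q_E_strict_mono in \<open>fastforce+\<close>)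

lemma homeomorphism_Q_E: "homeomorphism {0..1} {0..1} Q_E (inv_into {0..1} Q_E)"
proof -
  have "continuous_on (Q_E ` {0..1}) (inv_into {0..1} Q_E)"
    by (rule continuous_on_inv[OF continuous_on_Q_E]) (simp_all add: inv_into_f_f[OF inj_on_Q_E])
  moreover have "inv_into {0..1} Q_E ` (Q_E ` {0..1}) = {0..1}"
    by (rule inv_into_image_cancel[OF inj_on_Q_E]) simp
  ultimately show ?thesis
    using Q_E_image inj_on_Q_E continuous_on_Q_E
    by (auto simp: homeomorphism_def f_inv_into_f)
qed

section \<open>Linearization\<close>

lemma Q_E_F_E:
  assumes x: "x \<in> {0..1}"
  shows "Q_E (F_E x) = F_E_bar (Q_E x)"
proof -
  have "Q_E (F_E x) \<in> {0..1}" using Q_E_range F_E_range x by blast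
  then show ?thesis
    using Q_E_functional_equation[OF x]
    by (auto simp: F_E_bar_lift_def F_E_bar_def split: if_splits)
qed

text \<open>The point \<open>x / (1 - 2 j x)\<close> is the \<open>j\<close>-th image of \<open>x\<close> under \<^term>\<open>F_E\<close>, as long as all earlier
  images lie in \<open>[0,1/3]\<close>; the hypothesis says that they do.\<close>
lemma Q_E_neutral_branch:
  assumes "0 \<le> x" "(2 * real j + 1) * x \<le> 1"
  shows "Q_E x = Q_E (x / (1 - 2 * real j * x)) / 3 ^ j"
  using assms
proof (induction j)
  case (Suc j)
  define v where "v = x / (1 - 2 * real j * x)"
  have le: "2 * real j * x + 3 * x \<le> 1" using Suc.prems by (simp add: algebra_simps)
  then have pos: "1 - 2 * real j * x > 0" "1 - 2 * real j * x - 2 * x > 0"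
    using Suc.prems(1) by (cases "x = 0"; simp)+
  have v: "0 \<le> v" "v \<le> 1/3" using le pos Suc.prems(1) by (simp_all add: v_def field_simps)
  then have "v \<in> {0..1}" by simp
  from Q_E_functional_equation[OF this] have Qv: "Q_E v = Q_E (F_E v) / 3"
    unfolding F_E_bar_lift_def using v(2) by argo
  have Fv: "F_E v = x / (1 - 2 * real (Suc j) * x)"
  proof -
    have "1 - 2 * v = (1 - 2 * real j * x - 2 * x) / (1 - 2 * real j * x)"
      using pos by (simp add: v_def field_simps)
    moreover have "F_E v = v / (1 - 2 * v)" using v by (simp add: F_E_def)
    ultimately have "F_E v = x / (1 - 2 * real j * x - 2 * x)" using pos by (simp add: v_def)
    then show ?thesis by (simp add: algebra_simps)
  qed
  have Qx: "Q_E x = Q_E v / 3 ^ j"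
    using Suc le by (simp add: v_def algebra_simps)
  show ?case unfolding Qx Qv Fv by simp
qed simp

lemma Gauss_interval_exists:
  fixes t :: real
  assumes "1 \<le> t"
  shows "\<exists>k::nat. k \<ge> 1 \<and> 2 * real k - 1 \<le> t \<and> t \<le> 2 * real k + 1"
proof -
  define k where "k = nat \<lfloor>(t + 1) / 2\<rfloor>"
  have "\<lfloor>(t + 1) / 2\<rfloor> \<ge> 1" using assms by (simp add: le_floor_iff)
  then have k: "int k = \<lfloor>(t + 1) / 2\<rfloor>" "k \<ge> 1" unfolding k_def by linarith+
  then have "real k \<le> (t + 1) / 2" "(t + 1) / 2 < real k + 1" by linarith+
  then have "2 * real k - 1 \<le> t" "t \<le> 2 * real k + 1" by (simp_all add: field_simps)
  then show ?thesis using k(2) by blast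
qed

text \<open>If \<open>x\<close> lies in the interval of index \<open>k\<close>, then \<open>u = x / (1 - 2 (k - 1) x)\<close> lies in \<open>[1/3,1]\<close> and
  \<open>1/u = 1/x - 2 (k - 1)\<close>, hence \<open>T_E x = \<bar>1/u - 2\<bar> = F_E u\<close>. On the linear side \<open>3\<^sup>k Q_E x = 3 Q_E u\<close>
  and \<open>F_E_bar t = \<bar>3 t - 2\<bar>\<close> for \<open>t \<in> [1/3,1]\<close>.\<close>
lemma Q_E_T_E:
  assumes x: "x \<in> {0..1}"
  shows "Q_E (T_E x) = T_E_bar (Q_E x)"
proof (cases "x = 0")
  case True
  then show ?thesis by (simp add: T_E_0 Q_E_0 T_E_bar_0)
next
  case False
  then have pos: "x > 0" using x by simp
  then obtain k :: nat where k: "k \<ge> 1" "2 * real k - 1 \<le> 1 / x" "1 / x \<le> 2 * real k + 1"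
    using Gauss_interval_exists[of "1 / x"] x by auto
  \<comment> \<open>the number of applications of the branch at \<open>0\<close> before the last step\<close>
  define j where "j = k - 1"
  have kj: "k = Suc j" using k(1) by (simp add: j_def)
  have le: "(2 * real j + 1) * x \<le> 1" using k(2) pos by (simp add: kj field_simps)
  define u where "u = x / (1 - 2 * real j * x)"
  have den: "1 - 2 * real j * x > 0" using le pos by (simp add: algebra_simps)
  have inv_u: "1 / u = 1 / x - 2 * real j" using den pos by (simp add: u_def field_simps)
  have u_pos: "u > 0" using den pos by (simp add: u_def)
  have "1 \<le> 1 / u" "1 / u \<le> 3" using k inv_u by (simp_all add: kj)
  then have u: "1/3 \<le> u" "u \<le> 1" using u_pos by (simp_all add: field_simps)
  have Tx: "T_E x = \<bar>1 / u - 2\<bar>"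
  proof -
    have "x \<in> {1 / (2 * real k + 1) .. 1 / (2 * real k - 1)}"
      using k pos by (simp add: field_simps)
    then show ?thesis using T_E_eq[OF k(1)] inv_u by (simp add: kj)
  qed
  also have "\<dots> = F_E u"
    using u u_pos by (auto simp: F_E_def abs_if field_simps)
  finally have TF: "Q_E (T_E x) = F_E_bar (Q_E u)" using Q_E_F_E[of u] u by simp
  have Qx: "Q_E x = Q_E u / 3 ^ j"
    unfolding u_def using Q_E_neutral_branch[OF _ le] pos by simp
  have third: "Q_E (1/3) = 1/3"
    using Q_E_functional_equation[of "1/3"] by (simp add: F_E_bar_lift_def F_E_breakpoints Q_E_1)
  have Qu: "1/3 \<le> Q_E u" "Q_E u \<le> 1"
    using Q_E_mono[of "1/3" u] Q_E_range[of u] u third by auto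
  have "T_E_bar (Q_E x) = F_E_bar (Q_E u)"
  proof (rule T_E_bar_eq[OF k(1)])
    show "Q_E x \<in> {1 / 3 ^ k..2 / 3 ^ k} \<and> F_E_bar (Q_E u) = 2 - 3 ^ k * Q_E x \<or>
      Q_E x \<in> {2 / 3 ^ k..3 / 3 ^ k} \<and> F_E_bar (Q_E u) = 3 ^ k * Q_E x - 2"
      using Qu by (auto simp: Qx kj F_E_bar_def field_simps)
  qed
  then show ?thesis using TF by simp
qed

theorem proposition5:
  shows "homeomorphism {0..1} {0..1} Q_E (inv_into {0..1} Q_E) \<and>
    (\<forall>y\<in>{0..1}. (Q_E \<circ> F_E \<circ> inv_into {0..1} Q_E) y = F_E_bar y) \<and>
    (\<forall>y\<in>{0..1}. (Q_E \<circ> T_E \<circ> inv_into {0..1} Q_E) y = T_E_bar y)"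
proof -
  have "inv_into {0..1} Q_E y \<in> {0..1}" "Q_E (inv_into {0..1} Q_E y) = y" if "y \<in> {0..1}" for y
    using that Q_E_image inv_into_into[of y Q_E "{0..1}"] f_inv_into_f[of y Q_E "{0..1}"] by auto
  then show ?thesis
    using homeomorphism_Q_E Q_E_F_E Q_E_T_E by (metis comp_apply)
qed

end
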